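(* Let $n\ge1$ be an integer, let $\xi(1),\ldots,\xi(n)$ be centered martingale differences with respect to a filtration $F(0)\subset\cdots\subset F(n)$, and let $b(1),\ldots,b(n)$ be a predictable sequence of random variables with respect to this filtration such that ${\bf E}|b(i)\xi(i)|<\infty$ for all $i$. Put $W(n)=\sum_{i=1}^n b(i)\xi(i)$. Let $D$ be the set of all $(\alpha,\beta,\lambda,\mu)\in[1,\infty]^4$ with $1/\alpha+1/\beta=1$ and $1/\lambda+1/\mu=1$, and define, for $p\ge2$, $$\theta(p)=\inf_{(\alpha,\beta,\lambda,\mu)\in D}\left[(p-1)\cdot\psi_{2\lambda,b}(\alpha p)\cdot\nu_{2\mu,\xi}(\beta p)\right].$$ Suppose that $\theta(a)<\infty$ for some $a>2$. Then $$\left\|n^{-1/2}W(n)\right\|_{G\theta}\le1,$$ where $\|\eta\|_{G\theta}=\sup_{p\in[2,a)}|\eta|_p/\theta(p)$.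
   Context: For a real random variable $\eta$, $|\eta|_p=({\bf E}|\eta|^p)^{1/p}$ for $p\in[1,\infty)$ and $|\eta|_\infty$ is the essential supremum of $|\eta|$. Centered martingale differences with respect to the filtration $\{F(i)\}$ on a probability space $(\Omega,F,{\bf P})$, where $F(0)=\{\emptyset,\Omega\}$ and $F(i)\subset F(i+1)\subset F$, are integrable real random variables $\xi(i)$ such that ${\bf E}\xi(i)=0$, $\xi(i)$ is $F(i)$-measurable, and ${\bf E}(\xi(i)\mid F(k))=0$ almost surely for all $0\le k\le i-1$. Predictable means that $b(i)$ is $F(i-1)$-measurable for each $i\geq 1$. The natural functions of the random vectors are, for $q,\kappa\in[1,\infty]$, $$\psi_{\kappa,b}(q)=\left[n^{-1}\sum_{i=1}^n|b(i)|_q^\kappa\right]^{1/\kappa},\qquad \nu_{\kappa,\xi}(q)=\left[n^{-1}\sum_{i=1}^n|\xi(i)|_q^\kappa\right]^{1/\kappa},$$ with the maximum over $1\le i\le n$ when $\kappa=\infty$. Conventions: $1/\infty=0$, $\infty\cdot p=\infty$, $0\cdot\infty=0$, $0/0=0$, and $c/\infty=0$ for finite $c$. *)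

theory Defs
  imports "HOL-Probability.Probability"
begin

text \<open>Norms and exponents take values in \<^typ>\<open>ennreal\<close>. Its arithmetic provides the conventions
  \<open>0 * \<infinity> = 0\<close>, \<open>\<infinity> * p = \<infinity>\<close> for \<open>p > 0\<close>, \<open>0 / 0 = 0\<close> and \<open>c / \<infinity> = 0\<close>; moreover \<open>c / 0 = \<infinity>\<close> for \<open>c > 0\<close>.\<close>

text \<open>Only used with an exponent \<open>r > 0\<close>.\<close>
definition ennpowr :: "ennreal \<Rightarrow> real \<Rightarrow> ennreal" where
  "ennpowr x r = (if x = \<infinity> then \<infinity> else ennreal (enn2real x powr r))"

definition Lp_norm :: "'a measure \<Rightarrow> ennreal \<Rightarrow> ('a \<Rightarrow> real) \<Rightarrow> ennreal" where
  "Lp_norm M q f =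
     (if q = \<infinity> then esssup M (\<lambda>x. ennreal \<bar>f x\<bar>)
      else ennpowr (\<integral>\<^sup>+x. ennreal (\<bar>f x\<bar> powr enn2real q) \<partial>M) (1 / enn2real q))"

text \<open>The filtration is indexed by \<open>0..n\<close>; \<open>F i\<close> is used only through its space and its
  \<open>\<sigma>\<close>-algebra, the measure being always that of \<open>M\<close>.\<close>
definition filtration_upto :: "'a measure \<Rightarrow> nat \<Rightarrow> (nat \<Rightarrow> 'a measure) \<Rightarrow> bool" where
  "filtration_upto M n F \<longleftrightarrow>
     (\<forall>i\<le>n. subalgebra M (F i)) \<and>
     sets (F 0) = {{}, space M} \<and>
     (\<forall>i<n. sets (F i) \<subseteq> sets (F (Suc i)))"

definition centered_martingale_differences ::
    "'a measure \<Rightarrow> nat \<Rightarrow> (nat \<Rightarrow> 'a measure) \<Rightarrow> (nat \<Rightarrow> 'a \<Rightarrow> real) \<Rightarrow> bool" where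
  "centered_martingale_differences M n F \<xi> \<longleftrightarrow>
     (\<forall>i\<in>{1..n}.
        integrable M (\<xi> i) \<and>
        integral\<^sup>L M (\<xi> i) = 0 \<and>
        \<xi> i \<in> borel_measurable (F i) \<and>
        (\<forall>k\<le>i - 1. AE x in M. real_cond_exp M (F k) (\<xi> i) x = 0))"

definition predictable_upto ::
    "nat \<Rightarrow> (nat \<Rightarrow> 'a measure) \<Rightarrow> (nat \<Rightarrow> 'a \<Rightarrow> real) \<Rightarrow> bool" where
  "predictable_upto n F b \<longleftrightarrow> (\<forall>i\<in>{1..n}. b i \<in> borel_measurable (F (i - 1)))"

text \<open>\<open>natural_fun M n X \<kappa> q\<close> is \<open>\<psi>\<^bsub>\<kappa>,b\<^esub>(q)\<close> for \<open>X = b\<close> and \<open>\<nu>\<^bsub>\<kappa>,\<xi>\<^esub>(q)\<close> for \<open>X = \<xi>\<close>.\<close>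
definition natural_fun ::
    "'a measure \<Rightarrow> nat \<Rightarrow> (nat \<Rightarrow> 'a \<Rightarrow> real) \<Rightarrow> ennreal \<Rightarrow> ennreal \<Rightarrow> ennreal" where
  "natural_fun M n X \<kappa> q =
     (if \<kappa> = \<infinity> then (MAX i\<in>{1..n}. Lp_norm M q (X i))
      else ennpowr ((\<Sum>i=1..n. ennpowr (Lp_norm M q (X i)) (enn2real \<kappa>)) / of_nat n)
             (1 / enn2real \<kappa>))"

definition conj_exponents :: "(ennreal \<times> ennreal \<times> ennreal \<times> ennreal) set" where
  "conj_exponents = {(\<alpha>, \<beta>, l, m).
     1 \<le> \<alpha> \<and> 1 \<le> \<beta> \<and> 1 \<le> l \<and> 1 \<le> m \<and> 1 / \<alpha> + 1 / \<beta> = 1 \<and> 1 / l + 1 / m = 1}"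

definition theta_fun ::
    "'a measure \<Rightarrow> nat \<Rightarrow> (nat \<Rightarrow> 'a \<Rightarrow> real) \<Rightarrow> (nat \<Rightarrow> 'a \<Rightarrow> real) \<Rightarrow> real \<Rightarrow> ennreal" where
  "theta_fun M n b \<xi> p =
     (INF (\<alpha>, \<beta>, l, m)\<in>conj_exponents.
        ennreal (p - 1) * natural_fun M n b (2 * l) (\<alpha> * ennreal p)
          * natural_fun M n \<xi> (2 * m) (\<beta> * ennreal p))"

text \<open>In \<^typ>\<open>ennreal\<close> also \<open>\<infinity> / \<infinity> = 0\<close>. This case does not arise for \<^const>\<open>theta_fun\<close>: it is
  nondecreasing in \<open>p\<close>, so finiteness at \<open>a\<close> gives finiteness on \<open>[2, a)\<close>.\<close>
definition grand_Lebesgue_norm ::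
    "'a measure \<Rightarrow> real \<Rightarrow> (real \<Rightarrow> ennreal) \<Rightarrow> ('a \<Rightarrow> real) \<Rightarrow> ennreal" where
  "grand_Lebesgue_norm M a \<theta> \<eta> = (SUP p\<in>{2..<a}. Lp_norm M (ennreal p) \<eta> / \<theta> p)"

end

theory Submission
  imports Defs
begin

text \<open>For \<open>p \<ge> 2\<close> the two-point inequality
  \<open>(|a + b|\<^sup>p + |a - b|\<^sup>p) / 2 \<le> (a\<^sup>2 + (p - 1) b\<^sup>2)\<^bsup>p/2\<^esup>\<close> and convexity give the 2-smoothness of \<open>L\<^sub>p\<close>:
  \<open>|f + g|\<^sub>p\<^sup>2 + |f - g|\<^sub>p\<^sup>2 \<le> 2 |f|\<^sub>p\<^sup>2 + 2 (p - 1) |g|\<^sub>p\<^sup>2\<close>. If \<open>g\<close> has conditional expectation zero given a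
  \<open>\<sigma>\<close>-algebra for which \<open>f\<close> is measurable, then \<open>|f|\<^sub>p \<le> |f + t g|\<^sub>p\<close> for all \<open>t\<close> by Jensen, whence
  \<open>|f + g|\<^sub>p\<^sup>2 \<le> |f|\<^sub>p\<^sup>2 + 2 (p - 1) |g|\<^sub>p\<^sup>2\<close>; the superfluous factor 2 disappears on applying smoothness to
  \<open>f + (t/2) g\<close> and \<open>(t/2) g\<close> and iterating. Hence Rio's inequality
  \<open>|\<Sum> d(i)|\<^sub>p\<^sup>2 \<le> (p - 1) \<Sum> |d(i)|\<^sub>p\<^sup>2\<close> for martingale differences, here \<open>d(i) = b(i) \<xi>(i)\<close>;
  its constant \<open>\<surd>(p - 1)\<close> for the norm is at most the factor \<open>p - 1\<close> of \<open>\<theta>\<close>. Hoelder's inequality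
  in \<open>\<Omega>\<close> and then for the uniform measure on \<open>{1..n}\<close> separates \<open>b\<close> from \<open>\<xi>\<close>.\<close>

subsection \<open>Two-point inequality\<close>

text \<open>Jensen for the convex function \<open>x powr r\<close> with
  \<open>r = p / (p - 2)\<close>, applied at \<open>A powr (p - 2)\<close> and
  \<open>B powr (p - 2)\<close>. It bounds a second derivative by a power of the function itself in
  the two-point inequality.\<close>

lemma power_mean_two:
  fixes A B p :: real
  assumes "p > 2" "A > 0" "B > 0"
  shows "(A powr (p - 2) + B powr (p - 2)) / 2 \<le> ((A powr p + B powr p) / 2) powr (1 - 2 / p)"
proof -
  define r where "r = p / (p - 2)"
  have r: "r \<ge> 1" "r > 0" using assms by (auto simp: r_def field_simps)
  have rr: "(p - 2) * r = p" "1 - 2 / p = 1 / r" using assms by (auto simp: r_def field_simps)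
  let ?u = "A powr (p - 2)" and ?v = "B powr (p - 2)"
  have "((1 - 1/2) *\<^sub>R ?u + (1/2) *\<^sub>R ?v) powr r \<le> (1 - 1/2) * ?u powr r + (1/2) * ?v powr r"
    by (rule convex_onD[OF powr_convex[OF r(1)]]) (use assms in auto)
  then have "((?u + ?v) / 2) powr r \<le> (A powr p + B powr p) / 2"
    by (simp add: powr_powr rr add_divide_distrib)
  then have "(((?u + ?v) / 2) powr r) powr (1 / r) \<le> ((A powr p + B powr p) / 2) powr (1 / r)"
    using r by (intro powr_mono2) auto
  then show ?thesis using r assms by (simp add: powr_powr rr)
qed

text \<open>With \<open>F\<close> the left-hand side as a function of t, the difference
  \<open>F t powr (2 / p) - (p - 1) * t\<^sup>2\<close> is nonincreasing, and it equals 1 at t =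
  0.\<close>

lemma two_point_unit:
  fixes p t :: real
  assumes p: "p > 2" and t: "0 \<le> t" "t \<le> 1"
  shows "((1 + t) powr p + (1 - t) powr p) / 2 \<le> (1 + (p - 1) * t\<^sup>2) powr (p / 2)"
proof -
  define F where "F = (\<lambda>t::real. ((1 + t) powr p + (1 - t) powr p) / 2)"
  define F1 where "F1 = (\<lambda>t::real. p * ((1 + t) powr (p - 1) - (1 - t) powr (p - 1)) / 2)"
  define F2 where "F2 = (\<lambda>t::real. p * (p - 1) * (((1 + t) powr (p - 2) + (1 - t) powr (p - 2)) / 2))"
  have dF: "(F has_real_derivative F1 s) (at s)" if "0 \<le> s" "s < 1" for s
    unfolding F_def F1_def using that p by (auto intro!: derivative_eq_intros simp: field_simps)
  have dF1: "(F1 has_real_derivative F2 s) (at s)" if "0 \<le> s" "s < 1" for s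
    unfolding F1_def F2_def using that p
    by (auto intro!: derivative_eq_intros simp: field_simps)
  have F1_nonneg: "F1 s \<ge> 0" if "0 \<le> s" "s < 1" for s
    unfolding F1_def using that p powr_mono2[of "p - 1" "1 - s" "1 + s"] by simp
  have F_mono: "F s \<le> F s'" if "0 \<le> s" "s \<le> s'" "s' < 1" for s s'
  proof (rule DERIV_nonneg_imp_nondecreasing[OF that(2)])
    fix x assume "s \<le> x" "x \<le> s'"
    with that have "0 \<le> x" "x < 1" by auto
    then show "\<exists>y. (F has_real_derivative y) (at x) \<and> 0 \<le> y"
      using dF F1_nonneg by blast
  qed
  have F_pos: "F s > 0" if "0 \<le> s" "s \<le> 1" for s
    unfolding F_def using that by (smt (verit, best) powr_gt_zero powr_ge_zero half_gt_zero)
  \<comment> \<open>Since \<open>F1 0 = 0\<close>, the mean value theorem gives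
    \<open>F1 s = s * F2 z\<close> with z < s. The power mean inequality bounds \<open>F2 z\<close>
    by a power of \<open>F z\<close>, and monotonicity of \<open>F\<close> replaces z by s.\<close>
  have key: "F1 s \<le> p * (p - 1) * s * F s powr (1 - 2 / p)" if s: "0 < s" "s < 1" for s
  proof -
    have "\<exists>z. 0 < z \<and> z < s \<and> F1 s - F1 0 = (s - 0) * F2 z"
      using s by (intro MVT2 dF1) auto
    then obtain z where z: "0 < z" "z < s" "F1 s - F1 0 = (s - 0) * F2 z" by blast
    have "F2 z \<le> p * (p - 1) * F z powr (1 - 2 / p)"
      unfolding F2_def F_def using z s p
      by (intro mult_left_mono power_mean_two) auto
    also have "\<dots> \<le> p * (p - 1) * F s powr (1 - 2 / p)"
      using z s p F_pos[of z] F_mono[of z s]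
      by (intro mult_left_mono powr_mono2) auto
    finally have "s * F2 z \<le> s * (p * (p - 1) * F s powr (1 - 2 / p))" using s by simp
    moreover have "F1 0 = 0" by (simp add: F1_def)
    ultimately show ?thesis using z by (simp add: mult_ac)
  qed
  define G where "G = (\<lambda>t. F t powr (2 / p) - (p - 1) * t\<^sup>2)"
  have "G t \<le> G 0"
  \<comment> \<open>Only interior derivatives are used: for t = 1 the base \<open>1 - t\<close>
    vanishes at the endpoint. In the derivative the powers \<open>2 / p - 1\<close> and
    \<open>1 - 2 / p\<close> of \<open>F s\<close> cancel.\<close>
  proof (rule DERIV_nonpos_imp_decreasing_open[OF t(1)])
    fix s assume s: "0 < s" "s < t"
    let ?D = "2 / p * F s powr (2 / p - 1) * F1 s - (p - 1) * (2 * s)"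
    have "(G has_real_derivative ?D) (at s)"
      unfolding G_def using s t F_pos[of s]
      by (auto intro!: derivative_eq_intros dF simp: mult_ac)
    moreover have "?D \<le> 0"
    proof -
      have "2 / p * F s powr (2 / p - 1) * F1 s
          \<le> 2 / p * F s powr (2 / p - 1) * (p * (p - 1) * s * F s powr (1 - 2 / p))"
        using s t p key[of s] by (intro mult_left_mono) auto
      also have "\<dots> = 2 * (p - 1) * s * (F s powr (2 / p - 1) * F s powr (1 - 2 / p))"
        using p by simp
      also have "F s powr (2 / p - 1) * F s powr (1 - 2 / p) = 1"
        using F_pos[of s] s t by (simp flip: powr_add)
      finally show ?thesis by (simp add: algebra_simps)
    qed
    ultimately show "\<exists>y. (G has_real_derivative y) (at s) \<and> y \<le> 0" by blast
  next
    have "F s \<noteq> 0" if "s \<in> {0..t}" for s using F_pos[of s] that t by auto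
    then show "continuous_on {0..t} G"
      unfolding G_def F_def using p t
      by (auto intro!: continuous_intros continuous_on_powr')
  qed
  then have "F t powr (2 / p) \<le> 1 + (p - 1) * t\<^sup>2"
    by (simp add: G_def F_def)
  then have "(F t powr (2 / p)) powr (p / 2) \<le> (1 + (p - 1) * t\<^sup>2) powr (p / 2)"
    using p by (intro powr_mono2) auto
  then show ?thesis
    using p t F_pos[of t] by (simp add: powr_powr F_def)
qed

text \<open>For p > 2, homogeneity reduces the case |b| \<le> |a| to a unit first argument. If |b| >
  |a|, exchanging the two leaves the left side unchanged, and the right side for the exchanged pair
  is the smaller one because p - 1 \<ge> 1.\<close>

lemma two_point:
  fixes a b p :: real
  assumes p: "p \<ge> 2"
  shows "(\<bar>a + b\<bar> powr p + \<bar>a - b\<bar> powr p) / 2 \<le> (a\<^sup>2 + (p - 1) * b\<^sup>2) powr (p / 2)"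
proof (cases "p = 2")
  case True
  then show ?thesis by (simp add: powr_numeral power2_eq_square algebra_simps)
next
  case False
  with p have p2: "p > 2" by simp
  have ordered: "((u + v) powr p + (u - v) powr p) / 2 \<le> (u\<^sup>2 + (p - 1) * v\<^sup>2) powr (p / 2)"
    if uv: "0 \<le> v" "v \<le> u" for u v :: real
  proof (cases "u = 0")
    case False
    define t where "t = v / u"
    have t: "0 \<le> t" "t \<le> 1" "v = u * t" and u: "u > 0" using uv False by (auto simp: t_def)
    have "((u + v) powr p + (u - v) powr p) / 2 = u powr p * (((1 + t) powr p + (1 - t) powr p) / 2)"
      using t u by (simp add: powr_mult[symmetric] algebra_simps)
    also have "\<dots> \<le> u powr p * (1 + (p - 1) * t\<^sup>2) powr (p / 2)"
      using two_point_unit[OF p2 t(1,2)] by (intro mult_left_mono) auto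
    also have "u powr p = (u\<^sup>2) powr (p / 2)"
      using u by (simp add: powr_powr flip: powr_numeral)
    also have "(u\<^sup>2) powr (p / 2) * (1 + (p - 1) * t\<^sup>2) powr (p / 2) = (u\<^sup>2 + (p - 1) * v\<^sup>2) powr (p / 2)"
      using t p by (simp add: powr_mult[symmetric] algebra_simps power_mult_distrib)
    finally show ?thesis .
  qed (use uv in auto)
  have abs_eq: "\<bar>a + b\<bar> powr p + \<bar>a - b\<bar> powr p
      = (\<bar>a\<bar> + \<bar>b\<bar>) powr p + \<bar>\<bar>a\<bar> - \<bar>b\<bar>\<bar> powr p"
  proof -
    have "\<bar>a + b\<bar> = \<bar>a\<bar> + \<bar>b\<bar> \<and> \<bar>a - b\<bar> = \<bar>\<bar>a\<bar> - \<bar>b\<bar>\<bar>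
        \<or> \<bar>a - b\<bar> = \<bar>a\<bar> + \<bar>b\<bar> \<and> \<bar>a + b\<bar> = \<bar>\<bar>a\<bar> - \<bar>b\<bar>\<bar>"
      by arith
    then show ?thesis by auto
  qed
  show ?thesis
  proof (cases "\<bar>b\<bar> \<le> \<bar>a\<bar>")
    case True
    then show ?thesis using ordered[of "\<bar>b\<bar>" "\<bar>a\<bar>"] abs_eq by simp
  next
    case False
    then have "(\<bar>a + b\<bar> powr p + \<bar>a - b\<bar> powr p) / 2 \<le> (b\<^sup>2 + (p - 1) * a\<^sup>2) powr (p / 2)"
      using ordered[of "\<bar>a\<bar>" "\<bar>b\<bar>"] abs_eq by (simp add: add.commute)
    also have "\<dots> \<le> (a\<^sup>2 + (p - 1) * b\<^sup>2) powr (p / 2)"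
    proof (intro powr_mono2)
      have "a\<^sup>2 \<le> b\<^sup>2" using False by (simp add: abs_le_square_iff[symmetric])
      then have "(p - 2) * a\<^sup>2 \<le> (p - 2) * b\<^sup>2" using p by (intro mult_left_mono) auto
      then show "b\<^sup>2 + (p - 1) * a\<^sup>2 \<le> a\<^sup>2 + (p - 1) * b\<^sup>2" by (simp add: algebra_simps)
    qed (use p in auto)
    finally show ?thesis .
  qed
qed

subsection \<open>Smoothness of the norm\<close>

text \<open>On positive arguments this is convexity of \<open>x powr p\<close>. A zero argument is
  settled by \<open>s powr p \<le> s\<close> for 0 < s < 1, and signs by the triangle
  inequality.\<close>

lemma convex_on_abs_powr:
  fixes p :: real
  assumes p: "p \<ge> 1"
  shows "convex_on UNIV (\<lambda>x::real. \<bar>x\<bar> powr p)"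
proof (rule convex_onI)
  fix t x y :: real
  assume t: "0 < t" "t < 1"
  have shrink: "(s * z) powr p \<le> s * z powr p" if "0 < s" "s < 1" "0 \<le> z" for s z :: real
  proof -
    have "s powr p \<le> s powr 1" using that p by (intro powr_mono') auto
    then show ?thesis using that by (simp add: powr_mult mult_right_mono)
  qed
  have pos: "((1 - t) * u + t * v) powr p \<le> (1 - t) * u powr p + t * v powr p"
    if "u \<ge> 0" "v \<ge> 0" for u v
  proof (cases "u > 0 \<and> v > 0")
    case True
    then show ?thesis using convex_onD[OF powr_convex[OF p], of t u v] t by simp
  next
    case False
    with that have "u = 0 \<or> v = 0" by auto
    then show ?thesis using shrink[of t v] shrink[of "1 - t" u] t that p by auto
  qed
  have "\<bar>(1 - t) *\<^sub>R x + t *\<^sub>R y\<bar> powr p \<le> ((1 - t) * \<bar>x\<bar> + t * \<bar>y\<bar>) powr p"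
    using t p abs_triangle_ineq[of "(1 - t) * x" "t * y"]
    by (intro powr_mono2) (auto simp: abs_mult)
  then show "\<bar>(1 - t) *\<^sub>R x + t *\<^sub>R y\<bar> powr p \<le> (1 - t) * \<bar>x\<bar> powr p + t * \<bar>y\<bar> powr p"
    using pos[of "\<bar>x\<bar>" "\<bar>y\<bar>"] by simp
qed simp

text \<open>Jensen at the points a/A and b/B with weights A/(A+B) and B/(A+B), with equality for a =
  A, b = B. Integrated with A and B the norms in question, it does the work of Minkowski's
  inequality in L_r.\<close>

lemma powr_add_le_weighted:
  fixes a b A B r :: real
  assumes r: "r \<ge> 1" and ab: "a \<ge> 0" "b \<ge> 0" and AB: "A > 0" "B > 0"
  shows "(a + b) powr r \<le> (A + B) powr r * (A / (A + B) * (a powr r / A powr r) + B / (A + B) * (b powr r / B powr r))"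
proof -
  define t where "t = B / (A + B)"
  have t: "0 < t" "t < 1" "1 - t = A / (A + B)" using AB by (auto simp: t_def field_simps)
  have eq: "(A + B) * ((1 - t) * (a / A) + t * (b / B)) = a + b"
    using AB unfolding t(3) unfolding t_def by (simp add: distrib_left)
  have "((1 - t) * (a / A) + t * (b / B)) powr r \<le> (1 - t) * (a / A) powr r + t * (b / B) powr r"
    using convex_onD[OF convex_on_abs_powr[OF r], of t "a / A" "b / B"] t ab AB by simp
  then have "(A + B) powr r * ((1 - t) * (a / A) + t * (b / B)) powr r
      \<le> (A + B) powr r * ((1 - t) * (a powr r / A powr r) + t * (b powr r / B powr r))"
    using ab AB by (intro mult_left_mono) (auto simp: powr_divide)
  also have "(A + B) powr r * ((1 - t) * (a / A) + t * (b / B)) powr r = (a + b) powr r"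
    by (simp only: powr_mult[symmetric] eq)
  finally show ?thesis unfolding t(3) unfolding t_def .
qed

text \<open>The squared L_p norm as a real number, so that differences can be formed. It has this
  meaning only when |f|^p is integrable, as the integral defaults to 0 otherwise; integrability is
  therefore tracked separately.\<close>

definition Lp_sq :: "'a measure \<Rightarrow> real \<Rightarrow> ('a \<Rightarrow> real) \<Rightarrow> real" where
  "Lp_sq M p f = (\<integral>x. \<bar>f x\<bar> powr p \<partial>M) powr (2 / p)"

lemma Lp_sq_nonneg: "0 \<le> Lp_sq M p f"
  by (simp add: Lp_sq_def)

lemma Lp_sq_cmult:
  assumes "p > 0"
  shows "Lp_sq M p (\<lambda>x. c * f x) = c\<^sup>2 * Lp_sq M p f"
proof -
  have "(\<integral>x. \<bar>c * f x\<bar> powr p \<partial>M) = \<bar>c\<bar> powr p * (\<integral>x. \<bar>f x\<bar> powr p \<partial>M)"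
    by (simp add: abs_mult powr_mult)
  then show ?thesis
    using assms by (cases "c = 0") (simp_all add: Lp_sq_def powr_mult powr_powr powr_numeral)
qed

lemma integrable_abs_powr_cmult:
  fixes p c :: real
  shows "integrable M (\<lambda>x. \<bar>f x\<bar> powr p) \<Longrightarrow> integrable M (\<lambda>x. \<bar>c * f x\<bar> powr p)"
  by (simp add: abs_mult powr_mult)

lemma integrable_abs_powr_add:
  fixes p :: real
  assumes p: "p \<ge> 1" and [measurable]: "f \<in> borel_measurable M" "g \<in> borel_measurable M"
    and int: "integrable M (\<lambda>x. \<bar>f x\<bar> powr p)" "integrable M (\<lambda>x. \<bar>g x\<bar> powr p)"
  shows "integrable M (\<lambda>x. \<bar>f x + g x\<bar> powr p)"
proof (rule Bochner_Integration.integrable_bound)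
  show "integrable M (\<lambda>x. 2 powr p * ((\<bar>f x\<bar> powr p + \<bar>g x\<bar> powr p) / 2))"
    using int by simp
  have "\<bar>u + v\<bar> powr p \<le> 2 powr p * ((\<bar>u\<bar> powr p + \<bar>v\<bar> powr p) / 2)" for u v :: real
  proof -
    have "\<bar>(u + v) / 2\<bar> powr p \<le> (\<bar>u\<bar> powr p + \<bar>v\<bar> powr p) / 2"
      using convex_onD[OF convex_on_abs_powr[OF p], of "1/2" u v] by (simp add: add_divide_distrib)
    then show ?thesis by (simp add: powr_divide field_simps)
  qed
  then show "AE x in M. norm (\<bar>f x + g x\<bar> powr p)
      \<le> norm (2 powr p * ((\<bar>f x\<bar> powr p + \<bar>g x\<bar> powr p) / 2))"
    by (auto intro!: AE_I2)
qed measurable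

lemma Lp_sq_smoothness:
  fixes p :: real
  assumes p: "p \<ge> 2" and [measurable]: "f \<in> borel_measurable M" "g \<in> borel_measurable M"
    and int: "integrable M (\<lambda>x. \<bar>f x\<bar> powr p)" "integrable M (\<lambda>x. \<bar>g x\<bar> powr p)"
  shows "Lp_sq M p (\<lambda>x. f x + g x) + Lp_sq M p (\<lambda>x. f x - g x) \<le> 2 * Lp_sq M p f + 2 * (p - 1) * Lp_sq M p g"
proof -
  have zero: "AE x in M. h x = 0" if "Lp_sq M p h = 0" "integrable M (\<lambda>x. \<bar>h x\<bar> powr p)" for h
  proof -
    have "(\<integral>x. \<bar>h x\<bar> powr p \<partial>M) = 0" using that(1) by (simp add: Lp_sq_def)
    then have "AE x in M. \<bar>h x\<bar> powr p = 0"
      using that(2) by (subst (asm) integral_nonneg_eq_0_iff_AE) auto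
    then show ?thesis by eventually_elim simp
  qed
  have cong: "Lp_sq M p h = Lp_sq M p k"
    if "AE x in M. \<bar>h x\<bar> = \<bar>k x\<bar>" "h \<in> borel_measurable M" "k \<in> borel_measurable M" for h k
    unfolding Lp_sq_def using that
    by (intro arg_cong2[where f = "(powr)"] integral_cong_AE refl) auto
  \<comment> \<open>The weights below divide by both norms, so functions vanishing almost everywhere
    are treated apart.\<close>
  consider "Lp_sq M p f = 0" | "Lp_sq M p g = 0" | "Lp_sq M p f > 0" "Lp_sq M p g > 0"
    using Lp_sq_nonneg[of M p f] Lp_sq_nonneg[of M p g] by linarith
  then show ?thesis
  proof cases
    case 1
    note AE0 = zero[OF 1 int(1)]
    have "Lp_sq M p (\<lambda>x. f x + g x) = Lp_sq M p g" "Lp_sq M p (\<lambda>x. f x - g x) = Lp_sq M p g"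
      by (rule cong; use AE0 in force)+
    moreover have "0 \<le> (p - 2) * Lp_sq M p g"
      using p Lp_sq_nonneg by (intro mult_nonneg_nonneg) auto
    ultimately show ?thesis using 1 by (simp add: algebra_simps)
  next
    case 2
    note AE0 = zero[OF 2 int(2)]
    have "Lp_sq M p (\<lambda>x. f x + g x) = Lp_sq M p f" "Lp_sq M p (\<lambda>x. f x - g x) = Lp_sq M p f"
      by (rule cong; use AE0 in force)+
    then show ?thesis using 2 by simp
  next
    case 3
    define r where "r = p / 2"
    have r: "r \<ge> 1" "2 * r = p" "2 / p = 1 / r" using p by (auto simp: r_def)
    define A where "A = Lp_sq M p f"
    define B where "B = (p - 1) * Lp_sq M p g"
    have AB: "A > 0" "B > 0" using 3 p by (auto simp: A_def B_def)
    have Lp_sq_powr: "Lp_sq M p h powr r = (\<integral>x. \<bar>h x\<bar> powr p \<partial>M)" for h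
      using r p by (simp add: Lp_sq_def powr_powr)
    \<comment> \<open>\<open>c\<close> and \<open>d\<close> are the coefficients of |f|^p and |g|^p
      after the weighted Jensen inequality with a = f^2 and b = (p - 1) g^2. They are tuned so that
      the integrated bound is exactly \<open>(A + B) powr r\<close>.\<close>
    define c where "c = (A + B) powr r * (A / (A + B)) / A powr r"
    define d where "d = (A + B) powr r * (B / (A + B)) * (p - 1) powr r / B powr r"
    have pointwise: "(\<bar>f x + g x\<bar> powr p + \<bar>f x - g x\<bar> powr p) / 2
        \<le> c * \<bar>f x\<bar> powr p + d * \<bar>g x\<bar> powr p" for x
    proof -
      have sq: "(z\<^sup>2) powr r = \<bar>z\<bar> powr p" for z :: real
      proof -
        have "z\<^sup>2 = \<bar>z\<bar> powr 2" by (simp add: powr_numeral)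
        then show ?thesis by (simp only: powr_powr r(2))
      qed
      have rearrange: "P * (\<alpha> * (u / k) + \<beta> * (w * v / l)) = P * \<alpha> / k * u + P * \<beta> * w / l * v"
        for P \<alpha> \<beta> u v w k l :: real
        by (simp add: distrib_left)
      have "(\<bar>f x + g x\<bar> powr p + \<bar>f x - g x\<bar> powr p) / 2 \<le> ((f x)\<^sup>2 + (p - 1) * (g x)\<^sup>2) powr r"
        using two_point[OF p] by (simp add: r_def)
      also have "\<dots> \<le> c * \<bar>f x\<bar> powr p + d * \<bar>g x\<bar> powr p"
        using powr_add_le_weighted[OF r(1) _ _ AB, of "(f x)\<^sup>2" "(p - 1) * (g x)\<^sup>2"] p
        unfolding c_def d_def powr_mult sq rearrange by simp
      finally show ?thesis .
    qed
    have int_pm: "integrable M (\<lambda>x. \<bar>f x + g x\<bar> powr p)" "integrable M (\<lambda>x. \<bar>f x - g x\<bar> powr p)"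
      using integrable_abs_powr_add[of p f M g] integrable_abs_powr_add[of p f M "\<lambda>x. - g x"] p int
      by auto
    have "(Lp_sq M p (\<lambda>x. f x + g x) powr r + Lp_sq M p (\<lambda>x. f x - g x) powr r) / 2
        = (\<integral>x. (\<bar>f x + g x\<bar> powr p + \<bar>f x - g x\<bar> powr p) / 2 \<partial>M)"
      using int_pm by (simp add: Lp_sq_powr)
    also have "\<dots> \<le> (\<integral>x. c * \<bar>f x\<bar> powr p + d * \<bar>g x\<bar> powr p \<partial>M)"
      using int int_pm by (intro integral_mono pointwise) auto
    also have "\<dots> = c * A powr r + d * Lp_sq M p g powr r"
      using int by (simp add: A_def Lp_sq_powr)
    also have "d * Lp_sq M p g powr r = (A + B) powr r * (B / (A + B))"
    proof -
      have "(p - 1) powr r * Lp_sq M p g powr r = B powr r"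
        using p by (simp add: B_def powr_mult Lp_sq_nonneg)
      then have "d * Lp_sq M p g powr r = (A + B) powr r * (B / (A + B)) * (B powr r / B powr r)"
        unfolding d_def by (metis mult.assoc times_divide_eq_left times_divide_eq_right)
      then show ?thesis using AB by simp
    qed
    also have "c * A powr r = (A + B) powr r * (A / (A + B))"
      using AB by (simp add: c_def)
    also have "(A + B) powr r * (A / (A + B)) + (A + B) powr r * (B / (A + B)) = (A + B) powr r"
      using AB by (simp add: add_divide_distrib[symmetric] distrib_left[symmetric])
    finally have powr_le: "(Lp_sq M p (\<lambda>x. f x + g x) powr r + Lp_sq M p (\<lambda>x. f x - g x) powr r) / 2 \<le> (A + B) powr r" .
    \<comment> \<open>Midpoint convexity of the r-th power turns the bound on the mean of r-th
      powers into one on the mean itself.\<close>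
    have "((Lp_sq M p (\<lambda>x. f x + g x) + Lp_sq M p (\<lambda>x. f x - g x)) / 2) powr r
        \<le> (Lp_sq M p (\<lambda>x. f x + g x) powr r + Lp_sq M p (\<lambda>x. f x - g x) powr r) / 2"
      using convex_onD[OF convex_on_abs_powr[OF r(1)], of "1/2" "Lp_sq M p (\<lambda>x. f x + g x)" "Lp_sq M p (\<lambda>x. f x - g x)"]
      by (simp add: Lp_sq_nonneg add_divide_distrib)
    also note powr_le
    finally have "(Lp_sq M p (\<lambda>x. f x + g x) + Lp_sq M p (\<lambda>x. f x - g x)) / 2 \<le> A + B"
      using r AB powr_less_mono2[of r "A + B" "(Lp_sq M p (\<lambda>x. f x + g x) + Lp_sq M p (\<lambda>x. f x - g x)) / 2"]
      by linarith
    then have "Lp_sq M p (\<lambda>x. f x + g x) + Lp_sq M p (\<lambda>x. f x - g x) \<le> 2 * (A + B)" by simp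
    then show ?thesis unfolding A_def B_def distrib_left mult.assoc .
  qed
qed

text \<open>If \<open>h t \<le> (1 + \<epsilon>) * C * t\<^sup>2\<close> for all t, the halving
  inequality improves \<epsilon> to \<epsilon>/2. Starting from \<epsilon> = 1 and iterating, the
  limit removes it.\<close>

lemma le_of_halving:
  fixes h :: "real \<Rightarrow> real"
  assumes crude: "\<And>t. h t \<le> 2 * C * t\<^sup>2" and half: "\<And>t. h t \<le> 2 * h (t / 2) + C * t\<^sup>2 / 2"
  shows "h t \<le> C * t\<^sup>2"
proof -
  have bound: "h t \<le> (1 + (1 / 2) ^ k) * (C * t\<^sup>2)" for k t
  proof (induction k arbitrary: t)
    case 0
    then show ?case using crude[of t] by simp
  next
    case (Suc k)
    have "h t \<le> 2 * ((1 + (1 / 2) ^ k) * (C * (t / 2)\<^sup>2)) + C * t\<^sup>2 / 2"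
      using half[of t] Suc[of "t / 2"] by linarith
    also have "\<dots> = (1 + (1 / 2) ^ Suc k) * (C * t\<^sup>2)"
      by (simp add: power2_eq_square distrib_right add_divide_distrib)
    finally show ?case .
  qed
  have "(\<lambda>k. (1 + (1 / 2) ^ k) * (C * t\<^sup>2)) \<longlonglongrightarrow> (1 + 0) * (C * t\<^sup>2)"
    by (intro tendsto_intros LIMSEQ_realpow_zero) auto
  then show ?thesis using bound by (intro LIMSEQ_le_const) auto
qed

subsection \<open>Martingale differences\<close>

lemma integrable_of_abs_powr:
  fixes p :: real
  assumes "finite_measure M" "p \<ge> 1" and [measurable]: "f \<in> borel_measurable M"
    and int: "integrable M (\<lambda>x. \<bar>f x\<bar> powr p)"
  shows "integrable M f"
proof (rule Bochner_Integration.integrable_bound)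
  interpret finite_measure M by fact
  show "integrable M (\<lambda>x. 1 + \<bar>f x\<bar> powr p)" using int by simp
  have "\<bar>u\<bar> \<le> 1 + \<bar>u\<bar> powr p" for u :: real
  proof (cases "\<bar>u\<bar> \<le> 1")
    case False
    then have "\<bar>u\<bar> powr 1 \<le> \<bar>u\<bar> powr p" using assms(2) by (intro powr_mono) auto
    then show ?thesis by simp
  qed (simp add: add_increasing2)
  then show "AE x in M. norm (f x) \<le> norm (1 + \<bar>f x\<bar> powr p)"
    by (auto intro!: AE_I2 simp: abs_of_nonneg add_nonneg_nonneg)
qed measurable

context sigma_finite_subalgebra
begin

text \<open>X is the conditional expectation of X + Y, so the conditional Jensen inequality bounds
  |X|^p by the conditional expectation of |X + Y|^p; then integrate.\<close>

lemma Lp_sq_le_add_martingale_difference: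
  fixes p :: real
  assumes p: "p \<ge> 1" and [measurable]: "X \<in> borel_measurable F"
    and int: "integrable M X" "integrable M Y" "integrable M (\<lambda>x. \<bar>X x + Y x\<bar> powr p)"
    and intX: "integrable M (\<lambda>x. \<bar>X x\<bar> powr p)"
    and zero: "AE x in M. real_cond_exp M F Y x = 0"
  shows "Lp_sq M p X \<le> Lp_sq M p (\<lambda>x. X x + Y x)"
proof -
  have "AE x in M. \<bar>real_cond_exp M F (\<lambda>x. X x + Y x) x\<bar> powr p
      \<le> real_cond_exp M F (\<lambda>x. \<bar>X x + Y x\<bar> powr p) x"
    by (rule real_cond_exp_jensens_inequality(2)[where I = UNIV and q = "\<lambda>z. \<bar>z\<bar> powr p"])
      (use int convex_on_abs_powr[OF p] in auto)
  moreover have "AE x in M. real_cond_exp M F (\<lambda>x. X x + Y x) x = X x"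
    using real_cond_exp_add[OF int(1,2)] real_cond_exp_F_meas[OF int(1) assms(2)] zero
    by eventually_elim simp
  ultimately have "AE x in M. \<bar>X x\<bar> powr p \<le> real_cond_exp M F (\<lambda>x. \<bar>X x + Y x\<bar> powr p) x"
    by eventually_elim simp
  then have "(\<integral>x. \<bar>X x\<bar> powr p \<partial>M) \<le> (\<integral>x. real_cond_exp M F (\<lambda>x. \<bar>X x + Y x\<bar> powr p) x \<partial>M)"
    by (intro integral_mono_AE intX real_cond_exp_int int)
  then have "(\<integral>x. \<bar>X x\<bar> powr p \<partial>M) \<le> (\<integral>x. \<bar>X x + Y x\<bar> powr p \<partial>M)"
    using real_cond_exp_int(2)[OF int(3)] by simp
  then show ?thesis
    unfolding Lp_sq_def using p by (intro powr_mono2) auto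
qed

text \<open>The function g(t) = |X + tY|_p^2 has second differences at most 2 C s^2 by smoothness
  and is minimal at 0. Its increment \<open>g t - g 0\<close> then satisfies both hypotheses of
  \<open>le_of_halving\<close>.\<close>

lemma Lp_sq_add_martingale_difference:
  fixes p :: real
  assumes fin: "finite_measure M" and p: "p \<ge> 2"
    and X [measurable]: "X \<in> borel_measurable F" and Y [measurable]: "Y \<in> borel_measurable M"
    and int: "integrable M (\<lambda>x. \<bar>X x\<bar> powr p)" "integrable M (\<lambda>x. \<bar>Y x\<bar> powr p)"
    and zero: "AE x in M. real_cond_exp M F Y x = 0"
  shows "Lp_sq M p (\<lambda>x. X x + Y x) \<le> Lp_sq M p X + (p - 1) * Lp_sq M p Y"
proof -
  have [measurable]: "X \<in> borel_measurable M"
    using measurable_from_subalg[OF subalg X] .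
  have p1: "p \<ge> 1" using p by simp
  have intX: "integrable M X" and intY: "integrable M Y"
    by (rule integrable_of_abs_powr[OF fin p1 _ int(1)], measurable)
      (rule integrable_of_abs_powr[OF fin p1 _ int(2)], measurable)
  define C where "C = (p - 1) * Lp_sq M p Y"
  define g where "g = (\<lambda>t. Lp_sq M p (\<lambda>x. X x + t * Y x))"
  have int_t: "integrable M (\<lambda>x. \<bar>X x + t * Y x\<bar> powr p)" for t
    by (intro integrable_abs_powr_add integrable_abs_powr_cmult p1 int) auto
  have smooth: "g (t + s) + g (t - s) \<le> 2 * g t + 2 * C * s\<^sup>2" for t s
  proof -
    have "g (t + s) = Lp_sq M p (\<lambda>x. (X x + t * Y x) + s * Y x)"
      "g (t - s) = Lp_sq M p (\<lambda>x. (X x + t * Y x) - s * Y x)"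
      by (simp_all add: g_def algebra_simps)
    moreover have "2 * (p - 1) * Lp_sq M p (\<lambda>x. s * Y x) = 2 * C * s\<^sup>2"
      using p by (simp add: Lp_sq_cmult C_def)
    moreover have "Lp_sq M p (\<lambda>x. (X x + t * Y x) + s * Y x) + Lp_sq M p (\<lambda>x. (X x + t * Y x) - s * Y x)
        \<le> 2 * Lp_sq M p (\<lambda>x. X x + t * Y x) + 2 * (p - 1) * Lp_sq M p (\<lambda>x. s * Y x)"
      by (intro Lp_sq_smoothness p int_t integrable_abs_powr_cmult[OF int(2)]) measurable
    ultimately show ?thesis by (simp add: g_def)
  qed
  have ge: "g 0 \<le> g t" for t
  proof -
    have "AE x in M. real_cond_exp M F (\<lambda>x. t * Y x) x = 0"
      using real_cond_exp_cmult[OF intY, of t] zero by eventually_elim simp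
    then show ?thesis
      using Lp_sq_le_add_martingale_difference[OF p1 X intX _ int_t[of t] int(1)] intY
      by (simp add: g_def)
  qed
  have "g 1 - g 0 \<le> C * 1\<^sup>2"
  proof (rule le_of_halving)
    \<comment> \<open>Second difference centred at 0, with \<open>g (- t)\<close> bounded below by
      \<open>g 0\<close>.\<close>
    show "g t - g 0 \<le> 2 * C * t\<^sup>2" for t
      using smooth[of 0 t] ge[of "- t"] by simp
    \<comment> \<open>Second difference centred at t/2 with step t/2, whose outer points are t and
      0.\<close>
    show "g t - g 0 \<le> 2 * (g (t / 2) - g 0) + C * t\<^sup>2 / 2" for t
      using smooth[of "t / 2" "t / 2"] by (simp add: power_divide)
  qed
  then show ?thesis by (simp add: g_def C_def)
qed

end

section \<open>Sums of martingale differences along the filtration\<close>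

lemma sigma_finite_subalgebra_prob_space:
  assumes "prob_space M" "subalgebra M G"
  shows "sigma_finite_subalgebra M G"
proof -
  interpret prob_space M by fact
  have "finite_measure_subalgebra M G"
    using assms by (simp add: finite_measure_subalgebra_def finite_measure_axioms finite_measure_subalgebra_axioms_def)
  then show ?thesis by (rule finite_measure_subalgebra_is_sigma_finite)
qed

lemma sets_filtration_mono:
  assumes filt: "filtration_upto M n F" and "i \<le> j" "j \<le> n"
  shows "sets (F i) \<subseteq> sets (F j)"
  using assms(2,3)
proof (induction rule: dec_induct)
  case (step k)
  then have "k < n" by simp
  then have "sets (F k) \<subseteq> sets (F (Suc k))" using filt by (simp add: filtration_upto_def)
  then show ?case using step by simp
qed simp

lemma measurable_filtration_mono:
  assumes filt: "filtration_upto M n F" and "i \<le> j" "j \<le> n" and "f \<in> borel_measurable (F i)"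
  shows "f \<in> borel_measurable (F j)"
proof -
  have "subalgebra (F j) (F i)"
    using filt assms(2,3) sets_filtration_mono[OF assms(1-3)]
    by (auto simp: filtration_upto_def subalgebra_def)
  then show ?thesis using assms(4) by (rule measurable_from_subalg)
qed

lemma martingale_Lp_sq_bound:
  fixes p :: real
  assumes M: "prob_space M" and filt: "filtration_upto M n F" and p: "p \<ge> 2"
    and meas: "\<And>i. i \<in> {1..n} \<Longrightarrow> d i \<in> borel_measurable (F i)"
    and int: "\<And>i. i \<in> {1..n} \<Longrightarrow> integrable M (\<lambda>x. \<bar>d i x\<bar> powr p)"
    and zero: "\<And>i. i \<in> {1..n} \<Longrightarrow> AE x in M. real_cond_exp M (F (i - 1)) (d i) x = 0"
  shows "Lp_sq M p (\<lambda>x. \<Sum>i=1..n. d i x) \<le> (p - 1) * (\<Sum>i=1..n. Lp_sq M p (d i))"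
    and "integrable M (\<lambda>x. \<bar>\<Sum>i=1..n. d i x\<bar> powr p)"
proof -
  interpret prob_space M by fact
  have sub: "subalgebra M (F i)" if "i \<le> n" for i
    using filt that by (simp add: filtration_upto_def)
  \<comment> \<open>Integrability of the partial sum is carried through the induction, since adding
    the next difference requires it.\<close>
  have step: "Lp_sq M p (\<lambda>x. \<Sum>i=1..k. d i x) \<le> (p - 1) * (\<Sum>i=1..k. Lp_sq M p (d i))
      \<and> integrable M (\<lambda>x. \<bar>\<Sum>i=1..k. d i x\<bar> powr p)" if "k \<le> n" for k
    using that
  proof (induction k)
    case 0
    then show ?case by (simp add: Lp_sq_def)
  next
    case (Suc k)
    \<comment> \<open>Conditioning is on \<open>F k\<close>, which is \<open>F (i - 1)\<close> for
      the new index i = k + 1 and makes the partial sum measurable.\<close>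
    interpret G: sigma_finite_subalgebra M "F k"
      by (rule sigma_finite_subalgebra_prob_space[OF M sub]) (use Suc.prems in simp)
    let ?S = "\<lambda>x. \<Sum>i=1..k. d i x"
    have S: "?S \<in> borel_measurable (F k)"
    proof (rule borel_measurable_sum)
      fix i assume "i \<in> {1..k}"
      then show "d i \<in> borel_measurable (F k)"
        using meas[of i] Suc.prems by (intro measurable_filtration_mono[OF filt, of i k]) auto
    qed
    have SM: "?S \<in> borel_measurable M" by (rule measurable_from_subalg[OF G.subalg S])
    have dM: "d (Suc k) \<in> borel_measurable M"
      using measurable_from_subalg[OF sub meas] Suc.prems by simp
    have "Lp_sq M p (\<lambda>x. ?S x + d (Suc k) x) \<le> Lp_sq M p ?S + (p - 1) * Lp_sq M p (d (Suc k))"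
      by (rule G.Lp_sq_add_martingale_difference[OF finite_measure_axioms p S dM])
        (use Suc int zero[of "Suc k"] in auto)
    moreover have "integrable M (\<lambda>x. \<bar>?S x + d (Suc k) x\<bar> powr p)"
      using p Suc int by (intro integrable_abs_powr_add SM dM) auto
    ultimately show ?case using Suc by (simp add: distrib_left)
  qed
  show "Lp_sq M p (\<lambda>x. \<Sum>i=1..n. d i x) \<le> (p - 1) * (\<Sum>i=1..n. Lp_sq M p (d i))"
    and "integrable M (\<lambda>x. \<bar>\<Sum>i=1..n. d i x\<bar> powr p)"
    using step[of n] by auto
qed

subsection \<open>Hoelder's inequality\<close>

lemma ennpowr_ennreal: "0 \<le> x \<Longrightarrow> ennpowr (ennreal x) r = ennreal (x powr r)"
  by (simp add: ennpowr_def)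

lemma ennpowr_top [simp]: "ennpowr \<top> r = \<top>"
  by (simp add: ennpowr_def)

lemma ennpowr_0 [simp]: "ennpowr 0 r = 0"
  by (simp add: ennpowr_def)

lemma ennpowr_1 [simp]: "ennpowr x 1 = x"
  by (cases x) (auto simp: ennpowr_ennreal)

lemma ennpowr_eq_0_iff [simp]: "ennpowr x r = 0 \<longleftrightarrow> x = 0"
  by (cases x) (auto simp: ennpowr_ennreal)

lemma ennpowr_eq_top_iff [simp]: "ennpowr x r = \<top> \<longleftrightarrow> x = \<top>"
  by (simp add: ennpowr_def)

lemma ennpowr_mono: "0 \<le> r \<Longrightarrow> x \<le> y \<Longrightarrow> ennpowr x r \<le> ennpowr y r"
  by (cases x; cases y) (auto simp: ennpowr_ennreal top_unique intro!: ennreal_leI powr_mono2)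

text \<open>Valid for every r, also for the product of 0 and infinity, because
  \<open>ennpowr\<close> fixes both 0 and \<top>.\<close>

lemma ennpowr_mult: "ennpowr (x * y) r = ennpowr x r * ennpowr y r"
  by (cases x; cases y)
    (auto simp: ennpowr_ennreal powr_mult ennreal_mult_top ennreal_top_mult ennreal_mult[symmetric])

lemma ennpowr_ennpowr: "ennpowr (ennpowr x r) s = ennpowr x (r * s)"
  by (cases x) (auto simp: ennpowr_ennreal powr_powr)

lemma measurable_ennpowr [measurable]:
  assumes [measurable]: "f \<in> borel_measurable M"
  shows "(\<lambda>x. ennpowr (f x) r) \<in> borel_measurable M"
  unfolding ennpowr_def by measurable

text \<open>The scaling by \<open>u\<close> and \<open>v\<close> is chosen so that integrating the right-hand side gives exactly \<open>u * v\<close>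
  when \<open>\<integral>x\<^sup>s = u\<^sup>s\<close> and \<open>\<integral>y\<^sup>t = v\<^sup>t\<close>.\<close>
lemma ennreal_weighted_Young:
  fixes s t u v :: real
  assumes st: "s > 1" "t > 1" "1 / s + 1 / t = 1" and uv: "u > 0" "v > 0"
  shows "x * y \<le> ennreal (u * v / (s * u powr s)) * ennpowr x s + ennreal (u * v / (t * v powr t)) * ennpowr y t"
proof (cases "x = \<top> \<or> y = \<top>")
  case True
  have "ennreal (u * v / (s * u powr s)) \<noteq> 0" "ennreal (u * v / (t * v powr t)) \<noteq> 0"
    using st uv by (simp_all add: mult_less_0_iff not_le)
  with True show ?thesis by (auto simp: ennreal_mult_top)
next
  case False
  then obtain a b where ab: "x = ennreal a" "y = ennreal b" "a \<ge> 0" "b \<ge> 0"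
    by (cases x; cases y) auto
  have "a * b = u * v * ((a / u) * (b / v))" using uv by simp
  also have "\<dots> \<le> u * v * ((a / u) powr s / s + (b / v) powr t / t)"
    using st uv ab by (intro mult_left_mono Youngs_inequality) auto
  also have "\<dots> = u * v / (s * u powr s) * a powr s + u * v / (t * v powr t) * b powr t"
    using st uv ab by (simp add: powr_divide field_simps)
  finally show ?thesis
    using ab st uv
    by (simp add: ennpowr_ennreal ennreal_mult[symmetric] ennreal_plus[symmetric] ennreal_leI
        del: ennreal_plus)
qed

text \<open>If one integral on the right is 0, the product vanishes almost everywhere, even where
  the other factor is infinite. If both are nonzero and one is infinite, so is the bound. Otherwise
  the scaled Young inequality is integrated.\<close>

lemma nn_integral_Hoelder:
  fixes s t :: real
  assumes st: "s > 1" "t > 1" "1 / s + 1 / t = 1"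
    and [measurable]: "f \<in> borel_measurable M" "g \<in> borel_measurable M"
  shows "(\<integral>\<^sup>+x. f x * g x \<partial>M)
      \<le> ennpowr (\<integral>\<^sup>+x. ennpowr (f x) s \<partial>M) (1 / s) * ennpowr (\<integral>\<^sup>+x. ennpowr (g x) t \<partial>M) (1 / t)"
proof -
  let ?U = "\<integral>\<^sup>+x. ennpowr (f x) s \<partial>M" and ?V = "\<integral>\<^sup>+x. ennpowr (g x) t \<partial>M"
  consider "?U = 0 \<or> ?V = 0" | "?U \<noteq> 0" "?V \<noteq> 0" "?U = \<top> \<or> ?V = \<top>"
    | "?U \<noteq> 0" "?V \<noteq> 0" "?U \<noteq> \<top>" "?V \<noteq> \<top>"
    by blast
  then show ?thesis
  proof cases
    case 1
    then have "(AE x in M. f x = 0) \<or> (AE x in M. g x = 0)"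
      by (simp add: nn_integral_0_iff_AE)
    then have "AE x in M. f x * g x = 0" by auto
    then have "(\<integral>\<^sup>+x. f x * g x \<partial>M) = 0" by (simp add: nn_integral_0_iff_AE)
    then show ?thesis by simp
  next
    case 2
    then show ?thesis by (auto simp: ennreal_mult_top ennreal_top_mult)
  next
    case 3
    then obtain U V where UV: "?U = ennreal U" "?V = ennreal V" "U > 0" "V > 0"
      by (metis ennreal_0 ennreal_cases infinity_ennreal_def order_le_imp_less_or_eq)
    define u where "u = U powr (1 / s)"
    define v where "v = V powr (1 / t)"
    have uv: "u > 0" "v > 0" "u powr s = U" "v powr t = V"
      using UV st by (auto simp: u_def v_def powr_powr)
    have "(\<integral>\<^sup>+x. f x * g x \<partial>M) \<le> (\<integral>\<^sup>+x. ennreal (u * v / (s * u powr s)) * ennpowr (f x) s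
        + ennreal (u * v / (t * v powr t)) * ennpowr (g x) t \<partial>M)"
      by (intro nn_integral_mono ennreal_weighted_Young st uv)
    also have "\<dots> = ennreal (u * v / (s * U)) * ennreal U + ennreal (u * v / (t * V)) * ennreal V"
      using uv UV by (simp add: nn_integral_add nn_integral_cmult)
    also have "\<dots> = ennreal (u * v * (1 / s + 1 / t))"
      using uv UV st by (simp add: ennreal_mult[symmetric] ennreal_plus[symmetric] field_simps del: ennreal_plus)
    also have "\<dots> = ennreal u * ennreal v" using st uv by (simp add: ennreal_mult)
    finally show ?thesis using UV st by (simp add: ennpowr_ennreal u_def v_def)
  qed
qed

text \<open>Taking \<^typ>\<open>ennreal\<close>-valued functions makes both \<^const>\<open>Lp_norm\<close> and \<^const>\<open>natural_fun\<close>
  (whose entries \<open>|b(i)|\<^sub>q\<close> may be infinite) instances, so one Hoelder inequality serves both.\<close>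
definition ennLp :: "'a measure \<Rightarrow> ennreal \<Rightarrow> ('a \<Rightarrow> ennreal) \<Rightarrow> ennreal" where
  "ennLp M q f =
     (if q = \<infinity> then esssup M f
      else ennpowr (\<integral>\<^sup>+x. ennpowr (f x) (enn2real q) \<partial>M) (1 / enn2real q))"

lemma ennLp_ennreal:
  "q > 0 \<Longrightarrow> ennLp M (ennreal q) f = ennpowr (\<integral>\<^sup>+x. ennpowr (f x) q \<partial>M) (1 / q)"
  by (simp add: ennLp_def)

lemma ennLp_top: "ennLp M \<top> f = esssup M f"
  by (simp add: ennLp_def)

lemma Lp_norm_eq_ennLp: "Lp_norm M q f = ennLp M q (\<lambda>x. ennreal \<bar>f x\<bar>)"
  by (simp add: Lp_norm_def ennLp_def ennpowr_ennreal)

lemma ennLp_mult_esssup: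
  assumes "q > 0" and [measurable]: "f \<in> borel_measurable M" "g \<in> borel_measurable M"
  shows "ennLp M (ennreal q) (\<lambda>x. f x * g x) \<le> ennLp M \<top> f * ennLp M (ennreal q) g"
proof -
  let ?S = "esssup M f"
  have "(\<integral>\<^sup>+x. ennpowr (f x * g x) q \<partial>M) \<le> (\<integral>\<^sup>+x. ennpowr ?S q * ennpowr (g x) q \<partial>M)"
  proof (rule nn_integral_mono_AE)
    show "AE x in M. ennpowr (f x * g x) q \<le> ennpowr ?S q * ennpowr (g x) q"
      using esssup_AE[of f M]
      by eventually_elim (use assms in \<open>auto simp: ennpowr_mult intro!: mult_right_mono ennpowr_mono\<close>)
  qed
  also have "\<dots> = ennpowr ?S q * (\<integral>\<^sup>+x. ennpowr (g x) q \<partial>M)"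
    by (simp add: nn_integral_cmult)
  finally have "ennpowr (\<integral>\<^sup>+x. ennpowr (f x * g x) q \<partial>M) (1 / q)
      \<le> ennpowr (ennpowr ?S q * (\<integral>\<^sup>+x. ennpowr (g x) q \<partial>M)) (1 / q)"
    using assms by (intro ennpowr_mono) auto
  then show ?thesis
    using assms by (simp add: ennLp_ennreal ennLp_top ennpowr_mult ennpowr_ennpowr)
qed

text \<open>An infinite exponent has reciprocal 0 and forces the other to be 1. Two finite exponents
  have positive reciprocals, so each reciprocal is below 1.\<close>

lemma conj_ennreal_cases:
  fixes \<alpha> \<beta> :: ennreal
  assumes "1 \<le> \<alpha>" "1 \<le> \<beta>" "1 / \<alpha> + 1 / \<beta> = 1"
  obtains "\<alpha> = \<top>" "\<beta> = 1" | "\<alpha> = 1" "\<beta> = \<top>"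
    | s t where "\<alpha> = ennreal s" "\<beta> = ennreal t" "s > 1" "t > 1" "1 / s + 1 / t = (1::real)"
proof (cases \<alpha>)
  case top
  then have "1 / \<beta> = 1" using assms by simp
  then have "\<beta> = 1" using one_divide_one_divide_ennreal[of \<beta>] by simp
  then show ?thesis using top that by blast
next
  case (real s)
  show ?thesis
  proof (cases \<beta>)
    case top
    then have "1 / \<alpha> = 1" using assms by simp
    then have "\<alpha> = 1" using one_divide_one_divide_ennreal[of \<alpha>] by simp
    then show ?thesis using top that by blast
  next
    case t: (real t)
    have ge: "s \<ge> 1" "t \<ge> 1" using assms real t by (simp_all add: ennreal_ge_1)
    have "ennreal (1 / s + 1 / t) = 1"
      using assms(3) real t ge by (simp add: divide_ennreal ennreal_1[symmetric] del: ennreal_1)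
    then have eq: "1 / s + 1 / t = 1" by simp
    have "1 / s > 0" "1 / t > 0" using ge by auto
    then have "1 / s < 1" "1 / t < 1" using eq by linarith+
    then have "s > 1" "t > 1" using ge by (auto simp: field_simps)
    then show ?thesis using that real t eq by blast
  qed
qed

text \<open>Hoelder applied to the q-th powers, followed by a q-th root, multiplies both exponents
  by q. The endpoint pairs use the essential supremum, as \<top> times q is \<top>.\<close>

lemma ennLp_Hoelder:
  assumes q: "q > 0" and \<alpha>\<beta>: "1 \<le> \<alpha>" "1 \<le> \<beta>" "1 / \<alpha> + 1 / \<beta> = 1"
    and [measurable]: "f \<in> borel_measurable M" "g \<in> borel_measurable M"
  shows "ennLp M (ennreal q) (\<lambda>x. f x * g x)
      \<le> ennLp M (\<alpha> * ennreal q) f * ennLp M (\<beta> * ennreal q) g"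
  using \<alpha>\<beta>
proof (cases rule: conj_ennreal_cases)
  case 1
  then show ?thesis using ennLp_mult_esssup[of q f M g] q by (simp add: ennreal_top_mult)
next
  case 2
  then show ?thesis using ennLp_mult_esssup[of q g M f] q by (simp add: ennreal_top_mult mult.commute)
next
  case (3 s t)
  have "(\<integral>\<^sup>+x. ennpowr (f x * g x) q \<partial>M) \<le> ennpowr (\<integral>\<^sup>+x. ennpowr (ennpowr (f x) q) s \<partial>M) (1 / s)
      * ennpowr (\<integral>\<^sup>+x. ennpowr (ennpowr (g x) q) t \<partial>M) (1 / t)"
    unfolding ennpowr_mult by (rule nn_integral_Hoelder) (use 3 in auto)
  then have "ennpowr (\<integral>\<^sup>+x. ennpowr (f x * g x) q \<partial>M) (1 / q)
    \<le> ennpowr (ennpowr (\<integral>\<^sup>+x. ennpowr (ennpowr (f x) q) s \<partial>M) (1 / s)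
      * ennpowr (\<integral>\<^sup>+x. ennpowr (ennpowr (g x) q) t \<partial>M) (1 / t)) (1 / q)"
    using q by (intro ennpowr_mono) auto
  then show ?thesis
    using 3 q by (simp add: ennLp_ennreal ennreal_mult[symmetric] ennpowr_mult ennpowr_ennpowr mult.commute)
qed

section \<open>Averages over the indices as integrals\<close>

text \<open>Every point of A has positive mass, so almost everywhere means everywhere on A.\<close>

lemma esssup_uniform_count_measure:
  fixes f :: "'a \<Rightarrow> ennreal"
  assumes "finite A" "A \<noteq> {}"
  shows "esssup (uniform_count_measure A) f = (MAX x\<in>A. f x)"
proof (rule antisym)
  have AE: "(AE x in uniform_count_measure A. P x) \<longleftrightarrow> (\<forall>x\<in>A. P x)" for P
    using assms unfolding uniform_count_measure_def AE_point_measure by (auto simp: card_gt_0_iff)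
  show "esssup (uniform_count_measure A) f \<le> (MAX x\<in>A. f x)"
    by (rule esssup_I) (use assms in \<open>auto simp: AE\<close>)
  show "(MAX x\<in>A. f x) \<le> esssup (uniform_count_measure A) f"
    using esssup_AE[of f "uniform_count_measure A"] assms by (auto simp: AE)
qed

lemma nn_integral_uniform_count_measure:
  assumes "finite A"
  shows "(\<integral>\<^sup>+x. f x \<partial>uniform_count_measure A) = (\<Sum>x\<in>A. f x) / of_nat (card A)"
proof (cases "A = {}")
  case False
  then have "ennreal (1 / real (card A)) = inverse (of_nat (card A))"
    using assms by (simp add: inverse_eq_divide[symmetric] inverse_ennreal[symmetric] card_gt_0_iff ennreal_of_nat_eq_real_of_nat)
  then show ?thesis
    using assms by (simp add: uniform_count_measure_def nn_integral_point_measure_finite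
        divide_ennreal_def sum_distrib_right[symmetric] mult.commute)
qed (use assms in \<open>simp add: uniform_count_measure_def nn_integral_point_measure_finite\<close>)

text \<open>Makes Hoelder's inequality available for the averages over i, including the maximum at
  \<kappa> = \<infinity>.\<close>

lemma natural_fun_eq_ennLp:
  assumes "n \<ge> 1"
  shows "natural_fun M n X \<kappa> q = ennLp (uniform_count_measure {1..n}) \<kappa> (\<lambda>i. Lp_norm M q (X i))"
  using assms
  by (simp add: natural_fun_def ennLp_def esssup_uniform_count_measure nn_integral_uniform_count_measure)

subsection \<open>Norm estimates for martingale transforms\<close>

lemma Lp_norm_ennreal_integrable:
  assumes p: "p > 0" and int: "integrable M (\<lambda>x. \<bar>f x\<bar> powr p)"
  shows "Lp_norm M (ennreal p) f = ennreal (sqrt (Lp_sq M p f))"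
proof -
  have "Lp_norm M (ennreal p) f = ennreal ((\<integral>x. \<bar>f x\<bar> powr p \<partial>M) powr (1 / p))"
    using p int by (simp add: Lp_norm_def nn_integral_eq_integral ennpowr_ennreal)
  also have "(\<integral>x. \<bar>f x\<bar> powr p \<partial>M) powr (1 / p) = sqrt (Lp_sq M p f)"
    by (simp add: Lp_sq_def powr_powr flip: powr_half_sqrt)
  finally show ?thesis .
qed

lemma Lp_norm_ennreal_not_integrable:
  assumes p: "p > 0" and [measurable]: "f \<in> borel_measurable M"
    and int: "\<not> integrable M (\<lambda>x. \<bar>f x\<bar> powr p)"
  shows "Lp_norm M (ennreal p) f = \<top>"
proof -
  have "(\<integral>\<^sup>+x. ennreal (\<bar>f x\<bar> powr p) \<partial>M) = \<top>"
    using int by (simp add: integrable_iff_bounded less_top[symmetric])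
  then show ?thesis using p by (simp add: Lp_norm_def)
qed

lemma ennLp_uniform_count_measure:
  assumes "finite A" "q > 0"
  shows "ennLp (uniform_count_measure A) (ennreal q) f = ennpowr ((\<Sum>x\<in>A. ennpowr (f x) q) / of_nat (card A)) (1 / q)"
  using assms by (simp add: ennLp_ennreal nn_integral_uniform_count_measure)

lemma ennLp_mono:
  assumes "q > 0" "\<And>x. x \<in> space M \<Longrightarrow> f x \<le> g x"
  shows "ennLp M (ennreal q) f \<le> ennLp M (ennreal q) g"
  using assms by (simp add: ennLp_ennreal ennpowr_mono nn_integral_mono)

lemma martingale_Lp_norm_bound:
  fixes p :: real
  assumes M: "prob_space M" and filt: "filtration_upto M n F" and p: "p \<ge> 2" and n: "n \<ge> 1"
    and meas: "\<And>i. i \<in> {1..n} \<Longrightarrow> d i \<in> borel_measurable (F i)"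
    and zero: "\<And>i. i \<in> {1..n} \<Longrightarrow> AE x in M. real_cond_exp M (F (i - 1)) (d i) x = 0"
  shows "Lp_norm M (ennreal p) (\<lambda>x. real n powr (-1/2) * (\<Sum>i=1..n. d i x))
      \<le> ennreal (p - 1) * ennLp (uniform_count_measure {1..n}) 2 (\<lambda>i. Lp_norm M (ennreal p) (d i))"
    (is "_ \<le> _ * ?R")
proof (cases "\<forall>i\<in>{1..n}. integrable M (\<lambda>x. \<bar>d i x\<bar> powr p)")
  case True
  let ?W = "\<lambda>x. \<Sum>i=1..n. d i x"
  let ?s = "(\<Sum>i=1..n. Lp_sq M p (d i)) / real n"
  have W: "Lp_sq M p ?W \<le> (p - 1) * (\<Sum>i=1..n. Lp_sq M p (d i))"
      "integrable M (\<lambda>x. \<bar>?W x\<bar> powr p)"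
    using martingale_Lp_sq_bound[OF M filt p meas _ zero] True by auto
  have s: "?s \<ge> 0" by (simp add: sum_nonneg Lp_sq_nonneg)
  have "?R = ennpowr ((\<Sum>i=1..n. ennreal (Lp_sq M p (d i))) / of_nat n) (1 / 2)"
    using ennLp_uniform_count_measure[of "{1..n}" 2 "\<lambda>i. Lp_norm M (ennreal p) (d i)"] True p
    by (simp add: Lp_norm_ennreal_integrable ennpowr_ennreal powr_numeral Lp_sq_nonneg)
  also have "(\<Sum>i=1..n. ennreal (Lp_sq M p (d i))) / of_nat n = ennreal ?s"
    using n by (simp add: Lp_sq_nonneg sum_nonneg divide_ennreal ennreal_of_nat_eq_real_of_nat)
  also have "ennpowr (ennreal ?s) (1 / 2) = ennreal (sqrt ?s)"
    using s by (simp add: ennpowr_ennreal powr_half_sqrt)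
  finally have R: "?R = ennreal (sqrt ?s)" .
  \<comment> \<open>The squared normalization 1/n turns the sum of squared norms into the average
    inside \<open>?R\<close>.\<close>
  have sq: "(real n powr (-1/2))\<^sup>2 = 1 / real n"
    using n by (simp add: powr_minus powr_half_sqrt power_divide inverse_eq_divide)
  have "Lp_sq M p (\<lambda>x. real n powr (-1/2) * ?W x) = Lp_sq M p ?W / real n"
    using p by (simp only: Lp_sq_cmult sq) simp
  also have "\<dots> \<le> (p - 1) * ?s"
    using W(1) by (simp add: divide_right_mono)
  \<comment> \<open>Here p - 1 \<ge> 1 is used to weaken the constant, so that the square root
    yields the factor p - 1.\<close>
  also have "\<dots> \<le> (p - 1)\<^sup>2 * ?s"
    using p s mult_left_mono[of 1 "p - 1" "p - 1"] by (intro mult_right_mono) (auto simp: power2_eq_square)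
  finally have "sqrt (Lp_sq M p (\<lambda>x. real n powr (-1/2) * ?W x)) \<le> sqrt ((p - 1)\<^sup>2 * ?s)"
    by (rule real_sqrt_le_mono)
  also have "\<dots> = (p - 1) * sqrt ?s"
    unfolding real_sqrt_mult using p by simp
  finally have "Lp_norm M (ennreal p) (\<lambda>x. real n powr (-1/2) * ?W x) \<le> ennreal ((p - 1) * sqrt ?s)"
    using p W(2) by (simp add: Lp_norm_ennreal_integrable integrable_abs_powr_cmult ennreal_leI)
  then show ?thesis unfolding R using p s by (simp add: ennreal_mult)
next
  case False
  \<comment> \<open>One difference of infinite norm makes the average infinite; as p - 1 > 0, the
    right-hand side is \<top>.\<close>
  then obtain j where j: "j \<in> {1..n}" "\<not> integrable M (\<lambda>x. \<bar>d j x\<bar> powr p)" by blast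
  have "d j \<in> borel_measurable M"
    using measurable_from_subalg[of M "F j" "d j"] meas j filt by (auto simp: filtration_upto_def)
  then have "Lp_norm M (ennreal p) (d j) = \<top>"
    using j p by (intro Lp_norm_ennreal_not_integrable) auto
  then have "(\<Sum>i=1..n. ennpowr (Lp_norm M (ennreal p) (d i)) 2) = \<top>"
    using j by auto
  then have "?R = \<top>"
    using ennLp_uniform_count_measure[of "{1..n}" 2 "\<lambda>i. Lp_norm M (ennreal p) (d i)"]
    by (simp add: ennreal_divide_eq_top_iff)
  then show ?thesis using p by (simp add: ennreal_mult_top)
qed

lemma Lp_norm_Hoelder:
  assumes "q > 0" "1 \<le> \<alpha>" "1 \<le> \<beta>" "1 / \<alpha> + 1 / \<beta> = 1"
    and "f \<in> borel_measurable M" "g \<in> borel_measurable M"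
  shows "Lp_norm M (ennreal q) (\<lambda>x. f x * g x)
      \<le> Lp_norm M (\<alpha> * ennreal q) f * Lp_norm M (\<beta> * ennreal q) g"
  unfolding Lp_norm_eq_ennLp abs_mult ennreal_mult[OF abs_ge_zero abs_ge_zero]
  by (rule ennLp_Hoelder) (use assms in auto)

theorem theorem5p1:
  fixes M :: "'a measure" and F :: "nat \<Rightarrow> 'a measure"
    and \<xi> b :: "nat \<Rightarrow> 'a \<Rightarrow> real" and n :: nat and a :: real
  assumes "prob_space M"
    and "n \<ge> 1"
    and "filtration_upto M n F"
    and "centered_martingale_differences M n F \<xi>"
    and "predictable_upto n F b"
    and "\<And>i. i \<in> {1..n} \<Longrightarrow> integrable M (\<lambda>x. b i x * \<xi> i x)"
    and "a > 2"
    and "theta_fun M n b \<xi> a < \<infinity>"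
  shows "grand_Lebesgue_norm M a (theta_fun M n b \<xi>)
           (\<lambda>x. real n powr (-1/2) * (\<Sum>i=1..n. b i x * \<xi> i x)) \<le> 1"
proof -
  note filt = assms(3)
  let ?d = "\<lambda>i x. b i x * \<xi> i x"
  let ?\<eta> = "\<lambda>x. real n powr (-1/2) * (\<Sum>i=1..n. ?d i x)"
  let ?U = "uniform_count_measure {1..n}"
  have sub: "subalgebra M (F i)" if "i \<le> n" for i
    using filt that by (simp add: filtration_upto_def)
  have b_prev: "b i \<in> borel_measurable (F (i - 1))" and \<xi>_F: "\<xi> i \<in> borel_measurable (F i)"
    and \<xi>_zero: "AE x in M. real_cond_exp M (F (i - 1)) (\<xi> i) x = 0" if "i \<in> {1..n}" for i
    using assms(4,5) that
    by (auto simp: predictable_upto_def centered_martingale_differences_def)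
  have b_F: "b i \<in> borel_measurable (F i)" if "i \<in> {1..n}" for i
    using that by (intro measurable_filtration_mono[OF filt _ _ b_prev]) auto
  have b_M: "b i \<in> borel_measurable M" and \<xi>_M: "\<xi> i \<in> borel_measurable M" if "i \<in> {1..n}" for i
    using measurable_from_subalg[OF sub b_F] measurable_from_subalg[OF sub \<xi>_F] that by auto
  have d_F: "?d i \<in> borel_measurable (F i)" if "i \<in> {1..n}" for i
    using b_F[OF that] \<xi>_F[OF that] by (rule borel_measurable_times)
  \<comment> \<open>By predictability \<open>b i\<close> is \<open>F (i - 1)\<close>-measurable and
    factors out of the conditional expectation.\<close>
  have d_zero: "AE x in M. real_cond_exp M (F (i - 1)) (?d i) x = 0" if i: "i \<in> {1..n}" for i
  proof -
    interpret sigma_finite_subalgebra M "F (i - 1)"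
      by (rule sigma_finite_subalgebra_prob_space[OF assms(1) sub]) (use i in auto)
    show ?thesis
      using real_cond_exp_mult[OF b_prev[OF i] \<xi>_M[OF i] assms(6)[OF i]] \<xi>_zero[OF i]
      by eventually_elim simp
  qed
  \<comment> \<open>A bound for each admissible quadruple of exponents gives one for the
    infimum.\<close>
  have bound: "Lp_norm M (ennreal p) ?\<eta> \<le> theta_fun M n b \<xi> p" if p: "p \<ge> 2" for p
    unfolding theta_fun_def
  proof (rule INF_greatest, clarify)
    fix \<alpha> \<beta> l m
    assume "(\<alpha>, \<beta>, l, m) \<in> conj_exponents"
    then have e: "1 \<le> \<alpha>" "1 \<le> \<beta>" "1 / \<alpha> + 1 / \<beta> = 1" "1 \<le> l" "1 \<le> m" "1 / l + 1 / m = 1"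
      by (auto simp: conj_exponents_def)
    have "Lp_norm M (ennreal p) ?\<eta>
        \<le> ennreal (p - 1) * ennLp ?U (ennreal 2) (\<lambda>i. Lp_norm M (ennreal p) (?d i))"
      using martingale_Lp_norm_bound[OF assms(1) filt p assms(2) d_F d_zero] by simp
    also have "ennLp ?U (ennreal 2) (\<lambda>i. Lp_norm M (ennreal p) (?d i))
        \<le> ennLp ?U (ennreal 2) (\<lambda>i. Lp_norm M (\<alpha> * ennreal p) (b i) * Lp_norm M (\<beta> * ennreal p) (\<xi> i))"
      by (intro ennLp_mono Lp_norm_Hoelder e b_M \<xi>_M)
        (use p in \<open>auto simp: uniform_count_measure_def space_point_measure\<close>)
    \<comment> \<open>Second use of Hoelder, now over the indices with base exponent 2; this
      produces the exponents 2l and 2m.\<close>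
    also have "\<dots> \<le> ennLp ?U (l * ennreal 2) (\<lambda>i. Lp_norm M (\<alpha> * ennreal p) (b i))
        * ennLp ?U (m * ennreal 2) (\<lambda>i. Lp_norm M (\<beta> * ennreal p) (\<xi> i))"
      by (rule ennLp_Hoelder) (use e in \<open>auto simp: uniform_count_measure_def\<close>)
    also have "\<dots> = natural_fun M n b (2 * l) (\<alpha> * ennreal p) * natural_fun M n \<xi> (2 * m) (\<beta> * ennreal p)"
      using assms(2) by (simp add: natural_fun_eq_ennLp mult.commute)
    finally show "Lp_norm M (ennreal p) ?\<eta> \<le> ennreal (p - 1) * natural_fun M n b (2 * l) (\<alpha> * ennreal p)
        * natural_fun M n \<xi> (2 * m) (\<beta> * ennreal p)"
      by (simp add: mult.assoc mult_left_mono)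
  qed
  \<comment> \<open>For y = 0 also x = 0 and the quotient is 0 by convention; for y = \<top> it is 0
    as well.\<close>
  have "x / y \<le> 1" if "x \<le> y" for x y :: ennreal
    using divide_right_mono_ennreal[OF that, of y] ennreal_divide_self[of y] that
    by (cases "y = 0"; cases "y = \<top>") (auto simp: top.not_eq_extremum)
  then show ?thesis
    unfolding grand_Lebesgue_norm_def using bound by (intro SUP_least) auto
qed

end
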